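(* Let $X,Y$ be sets, $F\colon X\to Y$ a mapping, $\mathcal R\colon X\to\mathbb R\cup\{+\infty\}$ a functional, $W$ a family of functions $w\colon X\to\mathbb R$, $\beta\ge0$, and $x^\dagger\in X$. Assume the following: (1) There exists a monotonically increasing function $\psi\colon[0,\infty)\to[0,\infty)$ such that $\mathcal S(y_1,y_2)\le\psi\bigl(\mathcal S(y_1,y_3)+\mathcal S(y_2,y_3)\bigr)$ for all $y_1,y_2,y_3\in Y$. (2) The functional $\mathcal R$ is convex at $x^\dagger$ with respect to $W$. (3) There exist $w\in\partial_W\mathcal R(x^\dagger)$ and constants $\gamma_1\in[0,1)$, $\gamma_2\ge0$ such that \[ w(x^\dagger)-w(x)\le\gamma_1D_w(x,x^\dagger)+\gamma_2\,\mathcal S\bigl(F(x),F(x^\dagger)\bigr) \] for every $x\in\Phi_{\mathcal R}\bigl(F,F(x^\dagger),\psi(2\beta),\mathcal R(x^\dagger)\bigr)$. Let $y\in Y$ satisfy $\mathcal S(F(x^\dagger),y)\le\beta$. Then the estimate \[ D_w(x_\beta,x^\dagger)\le\frac{\gamma_2}{1-\gamma_1}\,\psi\bigl(\beta+\mathcal S(F(x^\dagger),y)\bigr) \] holds for all $x_\beta\in\Sigma(F,y,\beta)$.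
   Context: $\mathcal S\colon Y\times Y\to[0,+\infty]$ is a functional with $\mathcal S(y,z)=0$ if and only if $y=z$. For $z\in Y$, $\gamma\ge0$ and $t\in\mathbb R\cup\{+\infty\}$: \[ \Phi(F,z,\gamma):=\{x\in X:\mathcal S(F(x),z)\le\gamma\},\quad \Phi_{\mathcal R}(F,z,\gamma,t):=\Phi(F,z,\gamma)\cap\{x\in X:\mathcal R(x)\le t\}, \] \[ v(F,z,\gamma):=\inf\{\mathcal R(x):x\in\Phi(F,z,\gamma)\},\quad \Sigma(F,z,\gamma):=\{x\in\Phi(F,z,\gamma):\mathcal R(x)=v(F,z,\gamma)\}. \] The functional $\mathcal R$ is convex at $x^\dagger$ with respect to $W$ if $\mathcal R(x^\dagger)=\sup_{w\in W}\bigl(\inf_{x\in X}(\mathcal R(x)-w(x)+w(x^\dagger))\bigr)$. In this case the subdifferential at $x^\dagger$ with respect to $W$ is $\partial_W\mathcal R(x^\dagger):=\{w\in W:\mathcal R(x)\ge\mathcal R(x^\dagger)+w(x)-w(x^\dagger)\text{ for all }x\in X\}$, and for $w\in\partial_W\mathcal R(x^\dagger)$ and $x\in X$ the Bregman distance is $D_w(x,x^\dagger):=\mathcal R(x)-\mathcal R(x^\dagger)-w(x)+w(x^\dagger)$. *)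

theory Defs
  imports "HOL-Library.Extended_Nonnegative_Real"
begin

text \<open>
  The sets \<open>X\<close> and \<open>Y\<close> are the types \<open>'x\<close> and \<open>'y\<close>. The functional \<open>S\<close> takes values in
  \<open>[0, \<infinity>]\<close>, the type \<open>ennreal\<close>. The functional \<open>R\<close> takes values in \<open>ereal\<close>; that it avoids
  \<open>-\<infinity>\<close> has to be assumed separately.
\<close>

definition feasible :: "('y \<Rightarrow> 'y \<Rightarrow> ennreal) \<Rightarrow> ('x \<Rightarrow> 'y) \<Rightarrow> 'y \<Rightarrow> real \<Rightarrow> 'x set" where
  "feasible S F z \<gamma> = {x. S (F x) z \<le> ennreal \<gamma>}"

definition feasible_sublevel ::
  "('y \<Rightarrow> 'y \<Rightarrow> ennreal) \<Rightarrow> ('x \<Rightarrow> ereal) \<Rightarrow> ('x \<Rightarrow> 'y) \<Rightarrow> 'y \<Rightarrow> real \<Rightarrow> ereal \<Rightarrow> 'x set" where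
  "feasible_sublevel S R F z \<gamma> t = feasible S F z \<gamma> \<inter> {x. R x \<le> t}"

definition opt_value ::
  "('y \<Rightarrow> 'y \<Rightarrow> ennreal) \<Rightarrow> ('x \<Rightarrow> ereal) \<Rightarrow> ('x \<Rightarrow> 'y) \<Rightarrow> 'y \<Rightarrow> real \<Rightarrow> ereal" where
  "opt_value S R F z \<gamma> = (INF x\<in>feasible S F z \<gamma>. R x)"

definition solutions ::
  "('y \<Rightarrow> 'y \<Rightarrow> ennreal) \<Rightarrow> ('x \<Rightarrow> ereal) \<Rightarrow> ('x \<Rightarrow> 'y) \<Rightarrow> 'y \<Rightarrow> real \<Rightarrow> 'x set" where
  "solutions S R F z \<gamma> = {x \<in> feasible S F z \<gamma>. R x = opt_value S R F z \<gamma>}"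

definition convex_at_wrt :: "('x \<Rightarrow> ereal) \<Rightarrow> ('x \<Rightarrow> real) set \<Rightarrow> 'x \<Rightarrow> bool" where
  "convex_at_wrt R W a \<longleftrightarrow> R a = (SUP w\<in>W. INF x. R x - ereal (w x) + ereal (w a))"

definition subdifferential_wrt :: "('x \<Rightarrow> ereal) \<Rightarrow> ('x \<Rightarrow> real) set \<Rightarrow> 'x \<Rightarrow> ('x \<Rightarrow> real) set" where
  "subdifferential_wrt R W a = {w \<in> W. \<forall>x. R x \<ge> R a + ereal (w x) - ereal (w a)}"

text \<open>
  The Bregman distance is \<open>R x - R a - w x + w a\<close>. The case distinction only matters if
  \<open>R x = R a = \<infinity>\<close>, where the difference is otherwise meaningless (\<open>ereal\<close> would yield
  \<open>\<infinity> - \<infinity> = \<infinity>\<close>); there we read \<open>R x - R a\<close> as \<open>0\<close>.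
\<close>

definition bregman :: "('x \<Rightarrow> ereal) \<Rightarrow> ('x \<Rightarrow> real) \<Rightarrow> 'x \<Rightarrow> 'x \<Rightarrow> ereal" where
  "bregman R w x a = (if R x = R a then 0 else R x - R a) - ereal (w x) + ereal (w a)"

text \<open>
  A function \<open>[0, \<infinity>) \<rightarrow> [0, \<infinity>)\<close> has to be applied to sums of values of \<open>S\<close>, which may be
  infinite; as usual, it is extended by \<open>\<infinity> \<mapsto> \<infinity>\<close>.
\<close>

definition extend_top :: "(real \<Rightarrow> real) \<Rightarrow> ennreal \<Rightarrow> ennreal" where
  "extend_top \<psi> t = (if t = \<infinity> then \<infinity> else ennreal (\<psi> (enn2real t)))"

end

theory Submission
  imports Defs
begin

text \<open>
  Since \<open>xdag\<close> is itself feasible, minimality gives \<open>R x\<beta> \<le> R xdag\<close>, hence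
  \<open>bregman R w x\<beta> xdag \<le> w xdag - w x\<beta>\<close>. The source condition, which applies because
  \<open>S (F x\<beta>) (F xdag) \<le> \<psi> (\<beta> + S (F xdag) y) \<le> \<psi> (2 * \<beta>)\<close>, bounds the right-hand side by \<open>\<gamma>1\<close> times the
  Bregman distance plus \<open>\<gamma>2\<close> times the residual, and the Bregman term is absorbed on the left.
\<close>

lemma extend_top_ennreal: "0 \<le> t \<Longrightarrow> extend_top \<psi> (ennreal t) = ennreal (\<psi> t)"
  by (simp add: extend_top_def)

lemma extend_top_mono:
  assumes "mono_on {0..} \<psi>" and "s \<le> t"
  shows "extend_top \<psi> s \<le> extend_top \<psi> t"
proof (cases "t = \<infinity>")
  case False
  moreover from False \<open>s \<le> t\<close> have "s \<noteq> \<infinity>"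
    by (auto simp: top_unique)
  moreover have "\<psi> (enn2real s) \<le> \<psi> (enn2real t)"
    using assms False by (auto intro!: mono_onD[OF assms(1)] enn2real_mono simp: less_top)
  ultimately show ?thesis
    by (simp add: extend_top_def ennreal_leI)
qed (simp add: extend_top_def)

lemma solutions_le:
  assumes "x \<in> solutions S R F z \<gamma>" and "a \<in> feasible S F z \<gamma>"
  shows "R x \<le> R a"
  using assms by (auto simp: solutions_def opt_value_def intro: INF_lower)

text \<open>The difference \<open>R x - R a\<close> contributes at most 0. If both values are
  \<infinity>, this rests on the convention in \<open>bregman\<close>, since \<open>ereal\<close>
  subtraction would give \<infinity>.\<close>

lemma bregman_le:
  assumes "R x \<le> R a" and "R a \<noteq> -\<infinity>"
  shows "bregman R w x a \<le> ereal (w a - w x)"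
  using assms by (cases "R x"; cases "R a") (auto simp: bregman_def)

text \<open>For finite \<open>d\<close>, move \<open>g * d\<close> to the left and divide by
  \<open>1 - g > 0\<close>. The first assumption excludes \<open>d = \<infinity>\<close>, where this
  cancellation would fail; \<open>d = -\<infinity>\<close> is trivial.\<close>

lemma ereal_le_absorb:
  fixes d :: ereal and b c g s :: real
  assumes "d \<le> ereal b" and "ereal b \<le> ereal g * d + ereal (c * s)" and "g < 1"
  shows "d \<le> ereal (c / (1 - g)) * ereal s"
proof (cases d)
  case (real r)
  with assms have "r \<le> b" "b \<le> g * r + c * s"
    by auto
  then have "r * (1 - g) \<le> c * s"
    by (simp add: algebra_simps)
  then show ?thesis
    using real \<open>g < 1\<close> by (simp add: pos_le_divide_eq)
qed (use assms in auto)

theorem theorem5p4: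
  fixes S :: "'y \<Rightarrow> 'y \<Rightarrow> ennreal"
    and F :: "'x \<Rightarrow> 'y"
    and R :: "'x \<Rightarrow> ereal"
    and W :: "('x \<Rightarrow> real) set"
    and \<beta> \<gamma>1 \<gamma>2 :: real
    and xdag x\<beta> :: 'x
    and y :: 'y
    and \<psi> :: "real \<Rightarrow> real"
    and w :: "'x \<Rightarrow> real"
  assumes S_zero: "\<And>y z. S y z = 0 \<longleftrightarrow> y = z"
    and R_not_MInfty: "\<And>x. R x \<noteq> -\<infinity>"
    and beta: "\<beta> \<ge> 0"
    and psi_nonneg: "\<psi> \<in> {0..} \<rightarrow> {0..}"
    and psi_mono: "mono_on {0..} \<psi>"
    and S_psi: "\<And>y1 y2 y3. S y1 y2 \<le> extend_top \<psi> (S y1 y3 + S y2 y3)"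
    and R_convex: "convex_at_wrt R W xdag"
    and w: "w \<in> subdifferential_wrt R W xdag"
    and gamma1: "\<gamma>1 \<in> {0..<1}"
    and gamma2: "\<gamma>2 \<ge> 0"
    and source: "\<And>x. x \<in> feasible_sublevel S R F (F xdag) (\<psi> (2 * \<beta>)) (R xdag) \<Longrightarrow>
      ereal (w xdag - w x) \<le>
        ereal \<gamma>1 * bregman R w x xdag + ereal \<gamma>2 * enn2ereal (S (F x) (F xdag))"
    and y: "S (F xdag) y \<le> ennreal \<beta>"
    and x_beta: "x\<beta> \<in> solutions S R F y \<beta>"
  shows "bregman R w x\<beta> xdag \<le>
    ereal (\<gamma>2 / (1 - \<gamma>1)) * enn2ereal (extend_top \<psi> (ennreal \<beta> + S (F xdag) y))"
proof -
  \<comment> \<open>The bound by \<open>\<beta>\<close> makes this value finite, so the argument of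
    \<open>\<psi>\<close> on the right-hand side is a real number.\<close>
  obtain s where s: "S (F xdag) y = ennreal s" "0 \<le> s" "s \<le> \<beta>"
    using y beta by (cases "S (F xdag) y") (auto simp: top_unique)
  define p where "p = \<psi> (\<beta> + s)"
  \<comment> \<open>The second inequality, from \<open>s \<le> \<beta>\<close>, later places
    \<open>x\<beta>\<close> within the radius on which the source condition holds.\<close>
  have p: "0 \<le> p" "p \<le> \<psi> (2 * \<beta>)"
    using psi_nonneg beta s mono_onD[OF psi_mono, of "\<beta> + s" "2 * \<beta>"] by (auto simp: p_def)
  have ext: "extend_top \<psi> (ennreal \<beta> + S (F xdag) y) = ennreal p"
    using beta s by (simp add: p_def extend_top_ennreal flip: ennreal_plus)
  have "S (F x\<beta>) y \<le> ennreal \<beta>"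
    using x_beta by (simp add: solutions_def feasible_def)
  \<comment> \<open>Compare both points through the data \<open>y\<close>. Only the first summand is
    enlarged to \<open>\<beta>\<close>; keeping the second gives \<open>p\<close> instead of the
    coarser \<open>\<psi> (2 * \<beta>)\<close>.\<close>
  then have residual: "S (F x\<beta>) (F xdag) \<le> ennreal p"
    using S_psi[of "F x\<beta>" "F xdag" y] ext
      extend_top_mono[OF psi_mono, of "S (F x\<beta>) y + S (F xdag) y" "ennreal \<beta> + S (F xdag) y"]
    by (auto intro: add_right_mono)
  have le: "R x\<beta> \<le> R xdag"
    using solutions_le[OF x_beta] y by (simp add: feasible_def)
  have "x\<beta> \<in> feasible_sublevel S R F (F xdag) (\<psi> (2 * \<beta>)) (R xdag)"
    using residual p le order_trans[OF residual ennreal_leI]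
    by (simp add: feasible_sublevel_def feasible_def)
  note source[OF this]
  moreover have "ereal \<gamma>2 * enn2ereal (S (F x\<beta>) (F xdag)) \<le> ereal (\<gamma>2 * p)"
    using residual p gamma2
    by (auto simp: less_eq_ennreal.rep_eq enn2ereal_ennreal intro: ereal_mult_left_mono
        simp flip: times_ereal.simps(1))
  ultimately have "ereal (w xdag - w x\<beta>) \<le> ereal \<gamma>1 * bregman R w x\<beta> xdag + ereal (\<gamma>2 * p)"
    by (meson add_left_mono order_trans)
  \<comment> \<open>The real number \<open>w xdag - w x\<beta>\<close> serves as the intermediate
    bound \<open>b\<close> of the absorption lemma.\<close>
  with bregman_le[of R, OF le R_not_MInfty] gamma1
  have "bregman R w x\<beta> xdag \<le> ereal (\<gamma>2 / (1 - \<gamma>1)) * ereal p"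
    by (intro ereal_le_absorb) auto
  then show ?thesis
    using p by (simp only: ext enn2ereal_ennreal)
qed

end
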